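(* Let $A\subseteq\mathbb{Z}^d$ be a quasi-minimal configuration. Then $A$ is spiked or boxed.
   Context: A configuration is a finite set $A\subseteq\mathbb{Z}^d$. An affine functional $f$ is integer if $f(\mathbb{Z}^d)\subseteq\mathbb{Z}$ and primitive if $f(\mathbb{Z}^d)=\mathbb{Z}$. The width of a finite set or polytope $S$ (with respect to a lattice $\mathbb{Z}^k$) is the minimum over non-constant integer affine functionals $f$ of $\max_S f-\min_S f$ (it is $0$ if $S$ is not full-dimensional). For a configuration $A$ with $\mathrm{conv}(A)$ of width larger than one and a vertex $v$ of $\mathrm{conv}(A)$, put $A^v:=A\setminus\{v\}$; $v$ is essential if $\mathrm{conv}(A^v)$ has width at most one. $A$ (of width larger than one) is quasi-minimal if at most one vertex of $\mathrm{conv}(A)$ is not essential. A quasi-minimal $A\subseteq\mathbb{Z}^d$ is spiked if there is an affine map $\pi:\mathbb{R}^d\to\mathbb{R}^{d-1}$ with $\pi(\mathbb{Z}^d)=\mathbb{Z}^{d-1}$ (a lattice projection) such that, with $A':=\pi(A)\subseteq\mathbb{Z}^{d-1}$: every vertex of $\mathrm{conv}(A')$ has a unique preimage in $A$, and $\pi$ restricts to a bijection between the essential vertices of $A$ and the essential vertices of $A'$ (essentiality of $A'$ taken with respect to $\mathbb{Z}^{d-1}$); one then says $A$ is spiked with respect to $A'$. A configuration $A$ whose convex hull has width larger than one is boxed if there are affinely independent primitive integer affine functionals $f_1,\dots,f_d$ such that, with $Q:=\bigcap_{i=1}^d f_i^{-1}([0,1])$, we have $A\setminus Q=\{v_1,\dots,v_d\}$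 with $f_i(v_j)\notin\{0,1\}$ if and only if $i=j$; one says $A$ is boxed with respect to $Q$. *)

theory Defs
  imports "HOL-Analysis.Analysis"
begin

text \<open>
  The ambient dimension is \<open>d = CARD('n)\<close>. So that lattices of different ranks can occur in one
  statement (including rank \<open>0\<close>), the space of real vectors indexed by a finite set \<open>K\<close> is
  realised as the coordinate subspace of \<open>real ^ 'n\<close> of vectors supported on \<open>K\<close>. Thus \<open>K = UNIV\<close>
  gives the \<open>d\<close>-dimensional space with its standard lattice, and \<open>K = - {i}\<close> gives the
  \<open>(d - 1)\<close>-dimensional one.
\<close>

definition coord_space :: "'n::finite set \<Rightarrow> (real ^ 'n) set" where
  "coord_space K = {x. \<forall>i. i \<notin> K \<longrightarrow> x $ i = 0}"

definition int_lattice :: "'n::finite set \<Rightarrow> (real ^ 'n) set" where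
  "int_lattice K = {x \<in> coord_space K. \<forall>i. x $ i \<in> \<int>}"

definition affine_map :: "('a::real_vector \<Rightarrow> 'b::real_vector) \<Rightarrow> bool" where
  "affine_map f \<longleftrightarrow> (\<exists>l c. linear l \<and> f = (\<lambda>x. l x + c))"

text \<open>
  Functionals on \<open>coord_space K\<close> are given as restrictions of functionals on \<open>real ^ 'n\<close>; only
  their values on \<open>coord_space K\<close> matter below.
\<close>

definition integer_functional :: "'n::finite set \<Rightarrow> (real ^ 'n \<Rightarrow> real) \<Rightarrow> bool" where
  "integer_functional K f \<longleftrightarrow> affine_map f \<and> f ` int_lattice K \<subseteq> \<int>"

definition primitive_functional :: "'n::finite set \<Rightarrow> (real ^ 'n \<Rightarrow> real) \<Rightarrow> bool" where
  "primitive_functional K f \<longleftrightarrow> affine_map f \<and> f ` int_lattice K = \<int>"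

text \<open>
  For finite sets of lattice points and their convex hulls (with \<open>K\<close> nonempty) the infima and
  suprema below are attained. The rank-\<open>0\<close> lattice has no non-constant functionals, so the
  width of a point with respect to it is a junk value.
\<close>

definition width :: "'n::finite set \<Rightarrow> (real ^ 'n) set \<Rightarrow> real" where
  "width K S =
     (if affine hull S = coord_space K
      then INF f \<in> {f. integer_functional K f \<and> \<not> f constant_on coord_space K}.
             (SUP x\<in>S. f x) - (INF x\<in>S. f x)
      else 0)"

definition configuration :: "'n::finite set \<Rightarrow> (real ^ 'n) set \<Rightarrow> bool" where
  "configuration K A \<longleftrightarrow> finite A \<and> A \<subseteq> int_lattice K"

definition hull_vertices :: "(real ^ 'n::finite) set \<Rightarrow> (real ^ 'n) set" where
  "hull_vertices A = {v. v extreme_point_of (convex hull A)}"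

definition essential_vertices :: "'n::finite set \<Rightarrow> (real ^ 'n) set \<Rightarrow> (real ^ 'n) set" where
  "essential_vertices K A =
     {v \<in> hull_vertices A. width K (convex hull (A - {v})) \<le> 1}"

definition quasi_minimal :: "'n::finite set \<Rightarrow> (real ^ 'n) set \<Rightarrow> bool" where
  "quasi_minimal K A \<longleftrightarrow>
     configuration K A \<and> width K (convex hull A) > 1 \<and>
     (\<exists>\<^sub>\<le>\<^sub>1 v. v \<in> hull_vertices A - essential_vertices K A)"

text \<open>
  The target of the lattice projection is the coordinate hyperplane of some index \<open>i\<close>; by
  permuting coordinates, the choice of \<open>i\<close> is immaterial. When \<open>d \<ge> 2\<close>, functionals on the target
  pull back along \<open>p\<close>, so the projected configuration has width larger than one as well and it
  makes sense to speak of its essential vertices. When \<open>d = 1\<close>, the projection is a single point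
  with several preimages, so no configuration is spiked.
\<close>

definition spiked_wrt ::
  "'n::finite \<Rightarrow> (real ^ 'n \<Rightarrow> real ^ 'n) \<Rightarrow> (real ^ 'n) set \<Rightarrow> bool" where
  "spiked_wrt i p A \<longleftrightarrow>
     affine_map p \<and> p ` int_lattice UNIV = int_lattice (- {i}) \<and>
     (\<forall>u \<in> hull_vertices (p ` A). \<exists>!x. x \<in> A \<and> p x = u) \<and>
     bij_betw p (essential_vertices UNIV A) (essential_vertices (- {i}) (p ` A))"

definition spiked :: "(real ^ 'n::finite) set \<Rightarrow> bool" where
  "spiked A \<longleftrightarrow> quasi_minimal UNIV A \<and> (\<exists>i p. spiked_wrt i p A)"

text \<open>
  Affine independence of functionals is independence modulo constants: no nontrivial linear
  combination is constant, that is, the linear parts are linearly independent (so that, for \<open>d\<close>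
  functionals, the set \<open>Q\<close> of boxed configurations is a parallelepiped). This is stronger than
  affine independence of the functionals as points of the vector space of affine functionals.
\<close>

definition affinely_independent_functionals :: "('n::finite \<Rightarrow> real ^ 'n \<Rightarrow> real) \<Rightarrow> bool" where
  "affinely_independent_functionals f \<longleftrightarrow>
     (\<forall>c :: 'n \<Rightarrow> real. (\<lambda>x. \<Sum>i\<in>UNIV. c i * f i x) constant_on UNIV \<longrightarrow> (\<forall>i. c i = 0))"

definition boxed :: "(real ^ 'n::finite) set \<Rightarrow> bool" where
  "boxed A \<longleftrightarrow>
     configuration UNIV A \<and> width UNIV (convex hull A) > 1 \<and>
     (\<exists>(f :: 'n \<Rightarrow> real ^ 'n \<Rightarrow> real) (v :: 'n \<Rightarrow> real ^ 'n).
        (\<forall>i. primitive_functional UNIV (f i)) \<and>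
        affinely_independent_functionals f \<and>
        A - (\<Inter>i. f i -` {0..1}) = range v \<and>
        (\<forall>i j. f i (v j) \<notin> {0, 1} \<longleftrightarrow> i = j))"

end

theory Submission
  imports Defs
begin

text \<open>
  For an essential vertex \<open>v\<close> there is a primitive functional \<open>F\<^sub>v\<close> with values in \<open>{0, 1}\<close> on
  \<open>A - {v}\<close> but not at \<open>v\<close>. If the linear parts of the \<open>F\<^sub>v\<close> span the dual space, \<open>d\<close> of them form
  a basis and \<open>A\<close> is boxed with respect to these.

  Otherwise some nonzero lattice vector \<open>w\<close> is annihilated by all linear parts, so every \<open>F\<^sub>v\<close>
  factors through a lattice projection \<open>p\<close> along \<open>w\<close>; in particular an essential vertex is the only
  point of \<open>A\<close> in its fibre, and its image is an essential vertex of \<open>p(A)\<close>. If a vertex of \<open>p(A)\<close>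
  had two preimages in \<open>A\<close>, its fibre would be a face of the convex hull of \<open>A\<close> with at least two
  vertices, one of them essential by quasi-minimality, a contradiction. Hence \<open>A\<close> is spiked.
\<close>

section \<open>Width of convex hulls of finite sets\<close>

lemma convex_hull_affine_image:
  assumes "affine_map f" shows "f ` (convex hull S) = convex hull (f ` S)"
proof -
  obtain l c where l: "linear l" and f: "f = (\<lambda>x. l x + c)" using assms by (auto simp: affine_map_def)
  have "f ` (convex hull S) = (\<lambda>x. c + x) ` (l ` (convex hull S))" by (auto simp: f image_image add.commute)
  also have "\<dots> = convex hull ((\<lambda>x. c + x) ` (l ` S))"
    by (simp add: convex_hull_linear_image[OF l] convex_hull_translation)
  also have "(\<lambda>x. c + x) ` (l ` S) = f ` S" by (auto simp: f image_image add.commute)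
  finally show ?thesis .
qed

lemma affine_map_bounds_convex_hull:
  fixes f :: "'a::real_vector \<Rightarrow> real"
  assumes "affine_map f" "f ` S \<subseteq> {a..b}" "x \<in> convex hull S"
  shows "f x \<in> {a..b}"
proof -
  have "f x \<in> convex hull (f ` S)" using assms(3) convex_hull_affine_image[OF assms(1)] by blast
  moreover have "convex hull (f ` S) \<subseteq> {a..b}" by (rule hull_minimal) (use assms in auto)
  ultimately show ?thesis by blast
qed

text \<open>Turns the suprema and infima over a hull in \<open>width\<close> into a
  \<open>Max\<close> and \<open>Min\<close> over the generating set: an affine function maps the
  hull into the interval between its extreme values on \<open>S\<close>, and these are attained in
  \<open>S\<close>.\<close>

lemma range_convex_hull:
  fixes f :: "'a::real_vector \<Rightarrow> real"
  assumes f: "affine_map f" and S: "finite S" "S \<noteq> {}"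
  shows "(SUP x\<in>convex hull S. f x) = Max (f ` S)" "(INF x\<in>convex hull S. f x) = Min (f ` S)"
proof -
  have b: "f x \<in> {Min (f ` S)..Max (f ` S)}" if "x \<in> convex hull S" for x
    by (rule affine_map_bounds_convex_hull[OF f _ that]) (use S in auto)
  have "Max (f ` S) \<in> f ` S" "Min (f ` S) \<in> f ` S" using S by (auto intro!: Max_in Min_in)
  hence "Max (f ` S) \<in> f ` (convex hull S)" "Min (f ` S) \<in> f ` (convex hull S)"
    using hull_subset[of S convex] by auto
  then show "(SUP x\<in>convex hull S. f x) = Max (f ` S)" "(INF x\<in>convex hull S. f x) = Min (f ` S)"
    using b by (auto intro!: cSup_eq_maximum cInf_eq_minimum)
qed

text \<open>Ranges of functionals are nonnegative, so the infimum is over a set bounded below and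
  any single range bounds it from above. If the hull is not full-dimensional, its width is
  \<open>0\<close> by definition.\<close>

lemma width_convex_hull_le_1I:
  assumes f: "integer_functional K f" "\<not> f constant_on coord_space K"
    and S: "finite S" and le: "\<And>x y. x \<in> S \<Longrightarrow> y \<in> S \<Longrightarrow> f x - f y \<le> 1"
  shows "width K (convex hull S) \<le> 1"
proof (cases "affine hull (convex hull S) = coord_space K")
  case True
  let ?X = "{f. integer_functional K f \<and> \<not> f constant_on coord_space K}"
  have "0 \<in> coord_space K" by (simp add: coord_space_def)
  with True have ne: "S \<noteq> {}" by auto
  have val: "(SUP x\<in>convex hull S. g x) - (INF x\<in>convex hull S. g x) = Max (g ` S) - Min (g ` S)"
    if "g \<in> ?X" for g
    using that range_convex_hull[OF _ S ne] by (auto simp: integer_functional_def)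
  have nn: "0 \<le> Max (g ` S) - Min (g ` S)" for g :: "_ \<Rightarrow> real"
    using S ne by (metis Max_ge Max_in diff_ge_0_iff_ge finite_imageI image_is_empty Min_le)
  have "width K (convex hull S) = (INF g\<in>?X. Max (g ` S) - Min (g ` S))"
    using True val by (auto simp: width_def intro!: INF_cong)
  also have "\<dots> \<le> Max (f ` S) - Min (f ` S)"
    by (rule cINF_lower) (use f nn in \<open>auto intro!: bdd_belowI2[of _ 0]\<close>)
  also have "\<dots> \<le> 1"
  proof -
    have "Max (f ` S) \<in> f ` S" "Min (f ` S) \<in> f ` S" using S ne by (auto intro!: Max_in Min_in)
    thus ?thesis using le by auto
  qed
  finally show ?thesis .
qed (simp add: width_def)

text \<open>An infimum of at most \<open>1\<close> lies strictly below \<open>2\<close>, so some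
  functional has range less than \<open>2\<close>; its values on \<open>S\<close> are integers,
  hence differ by at most \<open>1\<close>. This avoids showing that the infimum is attained. Full
  dimension matters because a width of \<open>0\<close> by default yields no functional.\<close>

lemma width_convex_hull_le_1E:
  fixes S :: "(real ^ 'n) set"
  assumes w: "width K (convex hull S) \<le> 1" and full: "affine hull S = coord_space K"
    and K: "K \<noteq> {}" and S: "finite S" "S \<subseteq> int_lattice K"
  obtains f where "integer_functional K f" "\<not> f constant_on coord_space K"
    "\<And>x y. x \<in> S \<Longrightarrow> y \<in> S \<Longrightarrow> f x - f y \<le> 1"
proof -
  let ?X = "{f. integer_functional K f \<and> \<not> f constant_on coord_space K}"
  let ?v = "\<lambda>f. (SUP x\<in>convex hull S. f x) - (INF x\<in>convex hull S. f x)"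
  have "0 \<in> coord_space K" by (simp add: coord_space_def)
  with full have ne: "S \<noteq> {}" by auto
  obtain k where k: "k \<in> K" using K by auto
  \<comment> \<open>A coordinate functional shows that the infimum is over a nonempty set; for
    \<open>K = {}\<close> there would be no non-constant functional.\<close>
  have "(\<lambda>x::real^'n. x $ k) \<in> ?X"
  proof -
    have "affine_map (\<lambda>x::real^'n. x $ k)"
      unfolding affine_map_def by (rule exI[of _ "\<lambda>x. x $ k"], rule exI[of _ 0]) (simp add: linear_iff)
    moreover have "\<not> (\<lambda>x::real^'n. x $ k) constant_on coord_space K"
    proof
      assume "(\<lambda>x::real^'n. x $ k) constant_on coord_space K"
      moreover have "0 \<in> coord_space K" "axis k 1 \<in> coord_space K"
        using k by (auto simp: coord_space_def axis_def)
      ultimately have "(0::real^'n) $ k = axis k 1 $ k" unfolding constant_on_def by metis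
      thus False by simp
    qed
    ultimately show ?thesis by (auto simp: integer_functional_def int_lattice_def)
  qed
  hence "?v ` ?X \<noteq> {}" by blast
  moreover have "Inf (?v ` ?X) < 2" using w full by (simp add: width_def)
  ultimately obtain z where "z \<in> ?v ` ?X" "z < 2" by (rule cInf_lessD[elim_format]) blast
  then obtain f where f: "f \<in> ?X" and lt: "?v f < 2" by auto
  have v: "?v f = Max (f ` S) - Min (f ` S)"
    using f range_convex_hull[OF _ S(1) ne] by (auto simp: integer_functional_def)
  have int: "f x \<in> \<int>" if "x \<in> S" for x using that S f by (auto simp: integer_functional_def)
  have "f x - f y \<le> 1" if "x \<in> S" "y \<in> S" for x y
  proof -
    have "f x \<le> Max (f ` S)" "Min (f ` S) \<le> f y" using that S by auto
    with lt v have "f x - f y < 2" by linarith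
    moreover have "f x \<in> \<int>" "f y \<in> \<int>" using int that by auto
    then obtain m n where mn: "f x = of_int m" "f y = of_int n" by (auto elim!: Ints_cases)
    ultimately have "of_int (m - n) < (of_int 2 :: real)" by simp
    hence "m - n \<le> 1" unfolding of_int_less_iff by simp
    hence "of_int (m - n) \<le> (of_int 1 :: real)" unfolding of_int_le_iff .
    thus ?thesis by (simp add: mn)
  qed
  with f that show ?thesis by blast
qed

section \<open>Integer vectors and primitive functionals\<close>

lemma axis_int_lattice: "axis i 1 \<in> int_lattice UNIV"
  by (simp add: int_lattice_def coord_space_def axis_def)

lemma det_Ints:
  fixes M :: "real ^ 'n ^ 'n"
  assumes "\<And>i j. M $ i $ j \<in> \<int>" shows "det M \<in> \<int>"
  unfolding det_def by (intro Ints_sum Ints_mult Ints_prod) (use assms in auto)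

text \<open>Extend a maximal independent subset \<open>C\<close> of \<open>B\<close> by standard
  basis vectors to a basis \<open>D\<close>. Since \<open>C\<close> does not span, some
  \<open>d\<close> in \<open>D\<close> lies outside \<open>C\<close>, and the vector of the dual
  basis belonging to \<open>d\<close> is orthogonal to \<open>C\<close>, hence to \<open>B\<close>.
  Multiplying it by the determinant of the basis makes it integral.\<close>

lemma integer_orthogonal_vector:
  fixes B :: "(real ^ 'n) set"
  assumes B: "B \<subseteq> int_lattice UNIV" and span: "span B \<noteq> UNIV"
  obtains w where "w \<in> int_lattice UNIV" "w \<noteq> 0" "\<And>b. b \<in> B \<Longrightarrow> w \<bullet> b = 0"
proof -
  obtain C where C: "C \<subseteq> B" "independent C" "B \<subseteq> span C"
    using maximal_independent_subset[of B] by blast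
  let ?T = "C \<union> range (\<lambda>i. axis i 1)"
  obtain D where D: "C \<subseteq> D" "D \<subseteq> ?T" "independent D" "?T \<subseteq> span D"
    using maximal_independent_subset_extend[of C ?T] C by blast
  have "Basis \<subseteq> span D" using D(4) by (auto simp: Basis_vec_def)
  hence spanD: "span D = UNIV" by (metis span_Basis span_mono span_span top.extremum_uniqueI)
  have DZ: "D \<subseteq> int_lattice UNIV"
    using D(2) C(1) B axis_int_lattice by blast
  have finD: "finite D" using D(3) by (rule independent_imp_finite)
  have "card D = dim (UNIV :: (real^'n) set)" using D(3) spanD by (metis dim_span dim_eq_card_independent)
  hence "card D = CARD('n)" by simp
  then obtain h where h: "bij_betw h (UNIV::'n set) D"
    using finD by (metis finite finite_same_card_bij)
  have "D \<noteq> C"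
  proof
    assume "D = C"
    hence "span B = UNIV" using spanD C(1) span_mono by (metis top.extremum_uniqueI)
    with span show False by simp
  qed
  then obtain d where d: "d \<in> D" "d \<notin> C" using D(1) by blast
  obtain k where k: "h k = d" using h d by (metis bij_betw_imp_surj_on imageE)
  define M :: "real^'n^'n" where "M = (\<chi> i. h i)"
  have MZ: "M $ i $ j \<in> \<int>" for i j
  proof -
    have "h i \<in> D" using h by (auto simp: bij_betw_def)
    thus ?thesis using DZ by (auto simp: M_def int_lattice_def)
  qed
  have "rows M = D" using h by (auto simp: rows_def row_def M_def bij_betw_def)
  hence "invertible M"
    using matrix_left_invertible_span_rows[of M] spanD invertible_left_inverse by blast
  hence det: "det M \<noteq> 0" by (simp add: invertible_det_nz)
  \<comment> \<open>Cramer's rule, scaled by \<open>det M\<close> to make the solution integral\<close>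
  define w :: "real^'n" where "w = (\<chi> l. det (\<chi> i j. if j = l then axis k (1::real) $ i else M $ i $ j))"
  have "M *v ((1 / det M) *\<^sub>R w) = axis k 1"
    using cramer[OF det, of "(1 / det M) *\<^sub>R w" "axis k 1"] by (simp add: w_def vec_eq_iff)
  hence "M *v w = det M *\<^sub>R axis k 1"
    using det by (metis (no_types, opaque_lifting) divide_inverse matrix_vector_mult_scaleR mult_1 scaleR_one scaleR_scaleR right_inverse)
  hence Mw: "h i \<bullet> w = (if i = k then det M else 0)" for i
    by (auto simp: vec_eq_iff matrix_vector_mul_component M_def axis_def)
  show ?thesis
  proof
    show "w \<in> int_lattice UNIV"
      by (auto simp: int_lattice_def coord_space_def w_def axis_def MZ intro!: det_Ints)
    show "w \<noteq> 0" using Mw[of k] det by auto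
    fix b assume "b \<in> B"
    have "w \<bullet> c = 0" if "c \<in> C" for c
    proof -
      have "c \<in> range h" using h that D(1) by (auto simp: bij_betw_def)
      then obtain i where i: "h i = c" by blast
      have "i \<noteq> k" using d(2) k that i by metis
      thus ?thesis using Mw[of i] i by (simp add: inner_commute)
    qed
    moreover have "b \<in> span C" using C \<open>b \<in> B\<close> by auto
    ultimately show "w \<bullet> b = 0"
      using orthogonal_to_span[of b C w] by (auto simp: orthogonal_def)
  qed
qed

lemma integer_functional_UNIV_E:
  fixes f :: "real ^ 'n \<Rightarrow> real"
  assumes "integer_functional UNIV f"
  obtains a c where "a \<in> int_lattice UNIV" "c \<in> \<int>" "f = (\<lambda>x. a \<bullet> x + c)"
proof -
  obtain l c where l: "linear l" and f: "f = (\<lambda>x. l x + c)"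
    using assms by (auto simp: integer_functional_def affine_map_def)
  define a where "a = adjoint l 1"
  have fa: "f = (\<lambda>x. a \<bullet> x + c)"
    using adjoint_works[OF l, of _ 1] by (auto simp: f a_def inner_commute)
  have *: "f x \<in> \<int>" if "x \<in> int_lattice UNIV" for x using assms that by (auto simp: integer_functional_def)
  have c: "c \<in> \<int>" using *[of 0] by (simp add: fa int_lattice_def coord_space_def)
  have "a $ i \<in> \<int>" for i
  proof -
    have "a $ i + c \<in> \<int>" using *[OF axis_int_lattice, of i] by (simp add: fa inner_axis)
    thus ?thesis using c by (metis Ints_diff add_diff_cancel_right')
  qed
  with c fa that show ?thesis by (auto simp: int_lattice_def coord_space_def)
qed

lemma inner_int_lattice:
  "a \<in> int_lattice K \<Longrightarrow> b \<in> int_lattice L \<Longrightarrow> a \<bullet> b \<in> \<int>"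
  by (auto simp: int_lattice_def inner_vec_def intro!: Ints_sum Ints_mult)

lemma integer_functional_inner:
  "a \<in> int_lattice UNIV \<Longrightarrow> c \<in> \<int> \<Longrightarrow> integer_functional UNIV (\<lambda>x. a \<bullet> x + c)"
  by (auto simp: integer_functional_def affine_map_def intro!: exI[of _ "(\<bullet>) a"] exI[of _ c]
      bounded_linear.linear[OF bounded_linear_inner_right] Ints_add inner_int_lattice)

lemma inner_constant_on_iff:
  fixes a :: "real ^ 'n"
  shows "(\<lambda>x. a \<bullet> x + c) constant_on UNIV \<longleftrightarrow> a = 0"
proof
  assume "(\<lambda>x. a \<bullet> x + c) constant_on UNIV"
  hence "a \<bullet> a + c = a \<bullet> 0 + c" unfolding constant_on_def by (metis UNIV_I)
  thus "a = 0" by simp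
qed (auto simp: constant_on_def)

lemma coord_space_UNIV [simp]: "coord_space UNIV = UNIV"
  by (simp add: coord_space_def)

text \<open>Here \<open>g\<close> is the gcd of the coordinates of \<open>a\<close>, obtained as the
  least positive value of \<open>a\<close> on the lattice. A lattice point \<open>x\<close> where
  this value is attained is a Bezout vector, so after division by \<open>g\<close> the value at
  \<open>x\<close> is \<open>1\<close>.\<close>

lemma integer_vector_divide_content:
  fixes a :: "real ^ 'n"
  assumes a: "a \<in> int_lattice UNIV" "a \<noteq> 0"
  obtains b g x where "b \<in> int_lattice UNIV" "(g::real) \<ge> 1" "a = g *\<^sub>R b"
    "x \<in> int_lattice UNIV" "b \<bullet> x = 1"
proof -
  have aZ: "a $ i \<in> \<int>" for i using a by (auto simp: int_lattice_def)
  define P where "P n \<longleftrightarrow> n > 0 \<and> (\<exists>x\<in>int_lattice UNIV. a \<bullet> x = real n)" for n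
  have "\<exists>n. P n"
  proof -
    \<comment> \<open>The squared norm of \<open>a\<close> is itself a positive integer value of
      \<open>a\<close> on the lattice.\<close>
    have "a \<bullet> a > 0" "a \<bullet> a \<in> \<int>" using a by (auto intro: inner_int_lattice)
    then obtain z where z: "a \<bullet> a = of_int z" "z > 0" by (auto elim!: Ints_cases)
    hence "P (nat z)" unfolding P_def using a by (auto intro!: bexI[of _ a])
    thus ?thesis ..
  qed
  define g where "g = (LEAST n. P n)"
  have g: "P g" and least: "P n \<Longrightarrow> g \<le> n" for n
    using \<open>\<exists>n. P n\<close> by (auto simp: g_def intro: LeastI_ex Least_le)
  then obtain x where x: "x \<in> int_lattice UNIV" "a \<bullet> x = real g" and g0: "g > 0" by (auto simp: P_def)
  have div: "a $ i / real g \<in> \<int>" for i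
  proof -
    obtain z where z: "a $ i = of_int z" using aZ by (metis Ints_cases)
    \<comment> \<open>Division with remainder: \<open>?y\<close> is a lattice point at which
      \<open>a\<close> takes the value \<open>?r\<close>, and a nonzero remainder would contradict
      the minimality of \<open>g\<close>.\<close>
    let ?q = "z div int g" and ?r = "z mod int g"
    let ?y = "axis i 1 - of_int ?q *\<^sub>R x"
    have y: "?y \<in> int_lattice UNIV"
      using x(1) by (auto simp: int_lattice_def coord_space_def axis_def intro!: Ints_mult Ints_diff)
    have "a \<bullet> ?y = of_int (z - ?q * int g)"
      using z x(2) by (simp add: inner_diff_right inner_axis)
    also have "z - ?q * int g = ?r" by (simp add: minus_div_mult_eq_mod)
    finally have ay: "a \<bullet> ?y = of_int ?r" .
    have r: "0 \<le> ?r" "?r < int g" using g0 by auto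
    have "?r = 0"
    proof (rule ccontr)
      assume "?r \<noteq> 0"
      hence "P (nat ?r)" unfolding P_def using ay y r by (auto intro!: bexI[of _ ?y])
      from least[OF this] r show False by linarith
    qed
    hence "z = ?q * int g" by auto
    hence "a $ i = of_int ?q * real g" using z by (metis of_int_mult of_int_of_nat_eq)
    thus ?thesis using g0 by simp
  qed
  show ?thesis
  proof (rule that[of "(1 / real g) *\<^sub>R a" "real g" x])
    show "(1 / real g) *\<^sub>R a \<in> int_lattice UNIV"
      using div by (auto simp: int_lattice_def coord_space_def)
  qed (use g0 x in auto)
qed

lemma primitive_functional_inner:
  assumes "b \<in> int_lattice UNIV" "x \<in> int_lattice UNIV" "b \<bullet> x = 1" "c \<in> \<int>"
  shows "primitive_functional UNIV (\<lambda>x. b \<bullet> x + c)"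
proof -
  have i: "integer_functional UNIV (\<lambda>x. b \<bullet> x + c)" using assms by (intro integer_functional_inner)
  have "z \<in> (\<lambda>x. b \<bullet> x + c) ` int_lattice UNIV" if z: "z \<in> \<int>" for z
  proof (rule image_eqI)
    show "z = b \<bullet> ((z - c) *\<^sub>R x) + c" using assms by simp
    show "(z - c) *\<^sub>R x \<in> int_lattice UNIV"
      using assms z by (auto simp: int_lattice_def coord_space_def)
  qed
  with i show ?thesis by (auto simp: integer_functional_def primitive_functional_def)
qed


section \<open>Functionals attached to essential vertices\<close>

text \<open>A nonzero integer linear form of range at most one on \<open>A - {v}\<close> becomes
  primitive after division by its content, and a shift by its minimum gives values in
  \<open>{0, 1}\<close>. If its value at \<open>v\<close> were \<open>0\<close> or \<open>1\<close>
  as well, all of \<open>A\<close> would have width at most one.\<close>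

lemma essential_vertex_functional:
  fixes A :: "(real ^ 'n) set"
  assumes A: "finite A" "A \<subseteq> int_lattice UNIV" and wA: "width UNIV (convex hull A) > 1"
    and w: "width UNIV (convex hull (A - {v})) \<le> 1"
  obtains b c where "b \<in> int_lattice UNIV" "c \<in> \<int>" "b \<noteq> 0"
    "primitive_functional UNIV (\<lambda>x. b \<bullet> x + c)"
    "\<And>x. x \<in> A - {v} \<Longrightarrow> b \<bullet> x + c \<in> {0, 1}" "b \<bullet> v + c \<notin> {0, 1}"
proof -
  let ?S = "A - {v}"
  have S: "finite ?S" "?S \<subseteq> int_lattice UNIV" using A by auto
  have "\<exists>a. a \<in> int_lattice UNIV \<and> a \<noteq> 0 \<and> (\<forall>x\<in>?S. \<forall>y\<in>?S. a \<bullet> x - a \<bullet> y \<le> 1)"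
  proof (cases "affine hull ?S = UNIV")
    case True
    from width_convex_hull_le_1E[OF w _ _ S] True obtain f where
      f: "integer_functional UNIV f" "\<not> f constant_on UNIV"
        "\<And>x y. x \<in> ?S \<Longrightarrow> y \<in> ?S \<Longrightarrow> f x - f y \<le> 1"
      by auto
    obtain a c where a: "a \<in> int_lattice UNIV" "f = (\<lambda>x. a \<bullet> x + c)"
      using integer_functional_UNIV_E[OF f(1)] by metis
    have "a \<noteq> 0" using f(2) a(2) inner_constant_on_iff by metis
    moreover have "a \<bullet> x - a \<bullet> y \<le> 1" if "x \<in> ?S" "y \<in> ?S" for x y
      using f(3)[OF that] by (simp add: a(2))
    ultimately show ?thesis using a(1) by blast
  next
    \<comment> \<open>In the flat case the width is \<open>0\<close> by default and provides no
      functional. If \<open>?S\<close> is nonempty, an integer vector orthogonal to all differences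
      gives a form that is constant on \<open>?S\<close>; if it is empty, any nonzero lattice vector
      will do.\<close>
    case False
    show ?thesis
    proof (cases "?S = {}")
      case True
      show ?thesis unfolding True
        by (rule exI[of _ "axis undefined 1"]) (simp add: axis_int_lattice axis_eq_0_iff)
    next
      case ne: False
      then obtain x0 where x0: "x0 \<in> ?S" by blast
      let ?B = "(\<lambda>x. - x0 + x) ` ?S"
      have "affine hull ?S = (\<lambda>x. x0 + x) ` span ?B"
        by (rule affine_hull_span_gen) (use x0 in \<open>auto intro: hull_inc\<close>)
      with False have "span ?B \<noteq> UNIV" by (metis surj_plus)
      moreover have "?B \<subseteq> int_lattice UNIV"
      proof -
        have "x $ i \<in> \<int>" if "x \<in> ?S" for x i using S(2) that by (auto simp: int_lattice_def)
        with x0 show ?thesis by (auto simp: int_lattice_def coord_space_def intro!: Ints_diff)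
      qed
      ultimately obtain a where a: "a \<in> int_lattice UNIV" "a \<noteq> 0" "\<And>b. b \<in> ?B \<Longrightarrow> a \<bullet> b = 0"
        by (metis integer_orthogonal_vector)
      have "a \<bullet> x = a \<bullet> x0" if "x \<in> ?S" for x
        using a(3)[of "- x0 + x"] that by (auto simp: inner_diff_right)
      with a show ?thesis by (intro exI[of _ a]) auto
    qed
  qed
  then obtain a where a: "a \<in> int_lattice UNIV" "a \<noteq> 0"
    "\<And>x y. x \<in> ?S \<Longrightarrow> y \<in> ?S \<Longrightarrow> a \<bullet> x - a \<bullet> y \<le> 1" by blast
  obtain b g x where b: "b \<in> int_lattice UNIV" "(g::real) \<ge> 1" "a = g *\<^sub>R b"
    "x \<in> int_lattice UNIV" "b \<bullet> x = 1"
    using integer_vector_divide_content[OF a(1,2)] by metis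
  \<comment> \<open>Dividing by \<open>g\<close>, which is at least \<open>1\<close>, cannot push
    the range above \<open>1\<close>.\<close>
  have b_le: "b \<bullet> x - b \<bullet> y \<le> 1" if "x \<in> ?S" "y \<in> ?S" for x y
  proof -
    have "g * (b \<bullet> x - b \<bullet> y) \<le> 1" using a(3)[OF that] b(3) by (simp add: algebra_simps)
    show ?thesis
    proof (rule ccontr)
      assume "\<not> ?thesis"
      hence "g * (b \<bullet> x - b \<bullet> y) > 1" using b(2)
        by (smt (verit, best) mult_le_cancel_right1)
      with \<open>g * (b \<bullet> x - b \<bullet> y) \<le> 1\<close> show False by simp
    qed
  qed
  have bZ: "b \<bullet> x \<in> \<int>" if "x \<in> A" for x using that A b(1) by (auto intro: inner_int_lattice)
  have "\<exists>c\<in>\<int>. \<forall>x\<in>?S. b \<bullet> x + c \<in> {0, 1}"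
  proof (cases "?S = {}")
    case True show ?thesis unfolding True by (intro bexI[of _ 0]) simp_all
  next
    case False
    define m where "m = Min ((\<bullet>) b ` ?S)"
    have m: "m \<in> (\<bullet>) b ` ?S" using S(1) False by (auto simp: m_def intro!: Min_in)
    then obtain y where y: "y \<in> ?S" "m = b \<bullet> y" by auto
    have "b \<bullet> x + - m \<in> {0, 1}" if "x \<in> ?S" for x
    proof -
      have "m \<le> b \<bullet> x" using that S(1) by (simp add: m_def)
      moreover have "b \<bullet> x - m \<le> 1" using b_le[OF that y(1)] y(2) by simp
      moreover have "b \<bullet> x \<in> \<int>" "m \<in> \<int>" using bZ that y by auto
      then obtain p q where pq: "b \<bullet> x = of_int p" "m = of_int q" by (auto elim!: Ints_cases)
      ultimately have "p = q \<or> p = q + 1" by linarith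
      thus ?thesis by (auto simp: pq)
    qed
    thus ?thesis using bZ y by (intro bexI[of _ "- m"]) auto
  qed
  then obtain c where c: "c \<in> \<int>" "\<And>x. x \<in> ?S \<Longrightarrow> b \<bullet> x + c \<in> {0, 1}" by blast
  have "b \<noteq> 0" using b(5) by auto
  have "b \<bullet> v + c \<notin> {0, 1}"
  proof
    assume "b \<bullet> v + c \<in> {0, 1}"
    with c(2) have *: "b \<bullet> x + c \<in> {0, 1}" if "x \<in> A" for x using that by blast
    have "(b \<bullet> x + c) - (b \<bullet> y + c) \<le> 1" if "x \<in> A" "y \<in> A" for x y
      using *[OF that(1)] *[OF that(2)] by auto
    hence "width UNIV (convex hull A) \<le> 1"
      using \<open>b \<noteq> 0\<close> integer_functional_inner[OF b(1) c(1)] A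
      by (intro width_convex_hull_le_1I[of _ "\<lambda>x. b \<bullet> x + c"]) (auto simp: inner_constant_on_iff)
    with wA show False by simp
  qed
  with b(1) c(1) \<open>b \<noteq> 0\<close> primitive_functional_inner[OF b(1,4,5) c(1)] c(2) show ?thesis
    by (rule that[of b c])
qed

section \<open>Lattice automorphisms and lattice projections\<close>

text \<open>These maps form GL(d, Z); stating the invariance of the lattice directly avoids matrices
  and determinants.\<close>

definition lattice_automorphism :: "(real ^ 'n::finite \<Rightarrow> real ^ 'n) \<Rightarrow> bool" where
  "lattice_automorphism u \<longleftrightarrow> linear u \<and> bij u \<and> u ` int_lattice UNIV = int_lattice UNIV"

lemma lattice_automorphism_compose:
  "lattice_automorphism u \<Longrightarrow> lattice_automorphism t \<Longrightarrow> lattice_automorphism (u \<circ> t)"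
  unfolding lattice_automorphism_def image_comp[symmetric] by (auto intro: linear_compose bij_comp)

text \<open>The inverse is the shear with \<open>- s\<close>, which is integral as well. Such shears
  are the steps of the Euclidean algorithm on coordinates.\<close>

lemma lattice_automorphism_shear:
  fixes s :: real and j k :: "'n::finite"
  assumes s: "s \<in> \<int>" and jk: "j \<noteq> k"
  shows "lattice_automorphism (\<lambda>x. x + (s * x $ k) *\<^sub>R axis j 1)"
proof -
  define t :: "real \<Rightarrow> real ^ 'n \<Rightarrow> real ^ 'n" where "t r x = x + (r * x $ k) *\<^sub>R axis j 1" for r x
  have tt: "t r (t (- r) x) = x" for r x
    using jk by (simp add: t_def vec_eq_iff axis_def)
  have L: "t r x \<in> int_lattice UNIV" if "r \<in> \<int>" "x \<in> int_lattice UNIV" for r x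
    using that by (auto simp: t_def int_lattice_def coord_space_def axis_def)
  have "linear (t s)"
    by (rule linearI) (simp_all add: t_def algebra_simps)
  moreover have "bij (t s)"
    by (rule o_bij[of "t (- s)"]) (use tt[of "- s"] tt[of s] in \<open>auto simp: fun_eq_iff\<close>)
  moreover have "t s ` int_lattice UNIV = int_lattice UNIV"
  proof
    show "int_lattice UNIV \<subseteq> t s ` int_lattice UNIV"
    proof
      fix x :: "real ^ 'n" assume "x \<in> int_lattice UNIV"
      hence "t (- s) x \<in> int_lattice UNIV" using s by (intro L) auto
      thus "x \<in> t s ` int_lattice UNIV" using tt[of s x] by (metis image_eqI)
    qed
  qed (use L s in auto)
  ultimately show ?thesis by (auto simp: lattice_automorphism_def t_def[abs_def])
qed

text \<open>Euclidean algorithm on the coordinates; the termination measure is the 1-norm.\<close>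
lemma lattice_automorphism_to_axis:
  fixes w :: "real ^ 'n"
  assumes "w \<in> int_lattice UNIV" "w \<noteq> 0"
  shows "\<exists>u i c. lattice_automorphism u \<and> u w = c *\<^sub>R axis i 1"
  using assms
proof (induction "nat \<lfloor>\<Sum>i\<in>UNIV. \<bar>w $ i\<bar>\<rfloor>" arbitrary: w rule: less_induct)
  case less
  have wZ: "w $ i \<in> \<int>" for i using less.prems by (auto simp: int_lattice_def)
  show ?case
  proof (cases "\<exists>j k. j \<noteq> k \<and> w $ j \<noteq> 0 \<and> w $ k \<noteq> 0")
    case False
    obtain i where i: "w $ i \<noteq> 0" using less.prems(2) by (auto simp: vec_eq_iff)
    have "w = (w $ i) *\<^sub>R axis i 1" using False i by (auto simp: vec_eq_iff axis_def)
    moreover have "lattice_automorphism (\<lambda>x::real^'n. x)"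
      by (auto simp: lattice_automorphism_def linear_id[unfolded id_def] bij_id[unfolded id_def])
    ultimately show ?thesis by blast
  next
    case True
    then obtain j k where jk: "j \<noteq> k" "w $ j \<noteq> 0" "w $ k \<noteq> 0" "\<bar>w $ k\<bar> \<le> \<bar>w $ j\<bar>"
      by (metis linear)
    \<comment> \<open>With this sign the shear replaces |w_j| by |w_j| - |w_k|, so the 1-norm drops,
      while coordinate \<open>k\<close> is untouched and keeps the vector nonzero.\<close>
    define s where "s = - sgn (w $ j) * sgn (w $ k)"
    have s: "s \<in> \<int>" by (auto simp: s_def sgn_if)
    define t where "t = (\<lambda>x::real^'n. x + (s * x $ k) *\<^sub>R axis j 1)"
    have t: "lattice_automorphism t" unfolding t_def by (rule lattice_automorphism_shear[OF s jk(1)])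
    have tw: "t w \<in> int_lattice UNIV" using t less.prems(1) by (auto simp: lattice_automorphism_def)
    have twi: "t w $ i = (if i = j then w $ j + s * w $ k else w $ i)" for i
      by (simp add: t_def axis_def)
    have "t w $ k \<noteq> 0" using twi[of k] jk by auto
    hence tw0: "t w \<noteq> 0" by auto
    have "\<bar>t w $ j\<bar> < \<bar>w $ j\<bar>" using jk by (auto simp: twi s_def sgn_if abs_if split: if_splits)
    hence lt: "(\<Sum>i\<in>UNIV. \<bar>t w $ i\<bar>) < (\<Sum>i\<in>UNIV. \<bar>w $ i\<bar>)"
      by (intro sum_strict_mono_ex1) (auto simp: twi intro: less_imp_le)
    \<comment> \<open>The 1-norms are integers, so the strict decrease survives the rounding in the
      measure.\<close>
    have "(\<Sum>i\<in>UNIV. \<bar>x $ i\<bar>) \<in> \<int>" if "x \<in> int_lattice UNIV" for x :: "real^'n"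
      using that by (intro Ints_sum Ints_abs) (auto simp: int_lattice_def)
    from this[OF tw] this[OF less.prems(1)] obtain p q where
      pq: "(\<Sum>i\<in>UNIV. \<bar>t w $ i\<bar>) = of_int p" "(\<Sum>i\<in>UNIV. \<bar>w $ i\<bar>) = of_int q"
      by (auto elim!: Ints_cases)
    have "0 \<le> (\<Sum>i\<in>UNIV. \<bar>t w $ i\<bar>)" by (simp add: sum_nonneg)
    hence "nat \<lfloor>\<Sum>i\<in>UNIV. \<bar>t w $ i\<bar>\<rfloor> < nat \<lfloor>\<Sum>i\<in>UNIV. \<bar>w $ i\<bar>\<rfloor>"
      using lt unfolding pq by auto
    from less.hyps[OF this tw tw0] obtain u i c where
      u: "lattice_automorphism u" "u (t w) = c *\<^sub>R axis i 1" by blast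
    have "lattice_automorphism (u \<circ> t)" using u(1) t by (rule lattice_automorphism_compose)
    thus ?thesis using u(2) by (intro exI[of _ "u \<circ> t"]) auto
  qed
qed

text \<open>Move \<open>w\<close> onto a coordinate axis by an automorphism \<open>u\<close>;
  \<open>p\<close> is \<open>u\<close> followed by deleting that coordinate, and \<open>q\<close> is
  the inverse of \<open>u\<close>. Then \<open>q (p x)\<close> differs from \<open>x\<close> by a
  multiple of \<open>w\<close>, which is invisible to any \<open>a\<close> orthogonal to
  \<open>w\<close>. The map \<open>q\<close> serves to push such functionals down to the target of
  \<open>p\<close>.\<close>

lemma lattice_projection_along:
  fixes w :: "real ^ 'n"
  assumes w: "w \<in> int_lattice UNIV" "w \<noteq> 0"
  obtains i and p q :: "real ^ 'n \<Rightarrow> real ^ 'n" where "linear p" "linear q"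
    "p ` int_lattice UNIV = int_lattice (- {i})" "p ` UNIV = coord_space (- {i})"
    "q ` int_lattice UNIV \<subseteq> int_lattice UNIV"
    "\<And>a x. a \<bullet> w = 0 \<Longrightarrow> a \<bullet> q (p x) = a \<bullet> x"
proof -
  obtain u i c where u: "lattice_automorphism u" and uw: "u w = c *\<^sub>R axis i 1"
    using lattice_automorphism_to_axis[OF w] by blast
  have lu: "linear u" and bu: "bij u" and iu: "u ` int_lattice UNIV = int_lattice UNIV"
    using u by (auto simp: lattice_automorphism_def)
  define q where "q = inv u"
  have qu: "q (u x) = x" for x using bu by (simp add: q_def bij_is_inj)
  have lq: "linear q" using lu bu unfolding q_def
    by (metis bij_is_inj inj_linear_imp_inv_linear)
  define z where "z x = x - (x $ i) *\<^sub>R axis i 1" for x :: "real^'n"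
  have lz: "linear z" by (rule linearI) (simp_all add: z_def algebra_simps)
  have zi: "z x $ j = (if j = i then 0 else x $ j)" for x j by (simp add: z_def axis_def)
  have z_id: "z x = x" if "x \<in> coord_space (- {i})" for x
    using that by (auto simp: vec_eq_iff zi coord_space_def)
  have zL: "z ` int_lattice UNIV = int_lattice (- {i})"
  proof
    show "z ` int_lattice UNIV \<subseteq> int_lattice (- {i})"
      by (auto simp: int_lattice_def coord_space_def zi)
    show "int_lattice (- {i}) \<subseteq> z ` int_lattice UNIV"
    proof
      fix x :: "real^'n" assume "x \<in> int_lattice (- {i})"
      hence "z x = x" "x \<in> int_lattice UNIV" by (auto simp: int_lattice_def z_id)
      thus "x \<in> z ` int_lattice UNIV" by (metis image_eqI)
    qed
  qed
  have zU: "z ` UNIV = coord_space (- {i})"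
  proof
    show "z ` UNIV \<subseteq> coord_space (- {i})" by (auto simp: coord_space_def zi)
    show "coord_space (- {i}) \<subseteq> z ` UNIV" using z_id by (metis UNIV_I image_eqI subsetI)
  qed
  have "c \<noteq> 0"
  proof
    assume "c = 0"
    hence "u w = u 0" using uw linear_0[OF lu] by simp
    thus False using w(2) qu by metis
  qed
  hence qax: "q (axis i 1) = (1 / c) *\<^sub>R w"
    using qu[of w] uw linear_scale[OF lq, of c "axis i 1"] by auto
  show ?thesis
  proof (rule that[of "z \<circ> u" q i])
    show "linear (z \<circ> u)" using lu lz by (rule linear_compose)
    show "linear q" by fact
    show "(z \<circ> u) ` int_lattice UNIV = int_lattice (- {i})" by (simp only: image_comp[symmetric] iu zL)
    show "(z \<circ> u) ` UNIV = coord_space (- {i})"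
      by (simp only: image_comp[symmetric] bij_is_surj[OF bu] zU)
    show "q ` int_lattice UNIV \<subseteq> int_lattice UNIV"
    proof -
      have "q ` (u ` int_lattice UNIV) \<subseteq> int_lattice UNIV" using qu by auto
      thus ?thesis by (simp add: iu)
    qed
    fix a x assume "a \<bullet> w = 0"
    have "q ((z \<circ> u) x) = x - (u x $ i) *\<^sub>R ((1 / c) *\<^sub>R w)"
      by (simp add: z_def linear_diff[OF lq] linear_scale[OF lq] qu qax)
    thus "a \<bullet> q ((z \<circ> u) x) = a \<bullet> x" using \<open>a \<bullet> w = 0\<close> by (simp add: inner_diff_right)
  qed
qed

section \<open>Vertices of convex hulls and fibres of projections\<close>

lemma vertex_of_convex_hull_iff:
  fixes S :: "(real ^ 'n) set"
  assumes "finite S"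
  shows "u \<in> hull_vertices S \<longleftrightarrow> u \<in> S \<and> u \<notin> convex hull (S - {u})"
proof safe
  assume u: "u \<in> hull_vertices S"
  show "u \<in> S" using u extreme_point_of_convex_hull by (auto simp: hull_vertices_def)
  assume "u \<in> convex hull (S - {u})"
  moreover have "convex hull (S - {u}) \<subseteq> convex hull S" by (rule hull_mono) auto
  ultimately have "u extreme_point_of (convex hull (S - {u}))"
    using u by (auto simp: hull_vertices_def extreme_point_of_def)
  from extreme_point_of_convex_hull[OF this] show False by simp
next
  assume "u \<in> S" "u \<notin> convex hull (S - {u})"
  with extreme_point_of_convex_hull_insert[of "S - {u}" u] assms
  show "u \<in> hull_vertices S" by (simp add: hull_vertices_def insert_absorb)
qed

text \<open>The fibre of a vertex is a face of the convex hull of \<open>A\<close>. As a compact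
  convex set with two points it has two extreme points by the Krein-Milman theorem, and extreme
  points of a face are extreme points of the whole polytope.\<close>

lemma two_vertices_in_fibre:
  fixes A :: "(real ^ 'n) set" and p :: "real ^ 'n \<Rightarrow> real ^ 'n"
  assumes A: "finite A" and p: "linear p" and u: "u \<in> hull_vertices (p ` A)"
    and xy: "x \<in> A" "y \<in> A" "p x = u" "p y = u" "x \<noteq> y"
  obtains e e' where "e \<in> hull_vertices A" "e' \<in> hull_vertices A" "p e = u" "p e' = u" "e \<noteq> e'"
proof -
  let ?P = "convex hull A"
  let ?F = "?P \<inter> p -` {u}"
  have img: "p ` ?P = convex hull (p ` A)" using convex_hull_linear_image[OF p] .
  have cp: "convex (p -` {u})" using convex_linear_vimage[OF p] by simp
  have clp: "closed (p -` {u})"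
    using p by (intro closed_vimage) (auto simp: linear_continuous_on linear_linear)
  have F: "compact ?F" "convex ?F"
    using A cp clp by (auto intro: compact_Int_closed convex_Int finite_imp_compact_convex_hull)
  have face: "?F face_of ?P"
    unfolding face_of_def
  proof (intro conjI ballI impI)
    fix a b s assume ab: "a \<in> ?P" "b \<in> ?P" and s: "s \<in> ?F" "s \<in> open_segment a b"
    have pa: "p a \<in> convex hull (p ` A)" "p b \<in> convex hull (p ` A)" using ab img by auto
    obtain r where r: "0 < r" "r < 1" "s = (1 - r) *\<^sub>R a + r *\<^sub>R b"
      using s(2) by (auto simp: in_segment)
    have pu: "u = (1 - r) *\<^sub>R p a + r *\<^sub>R p b"
      using s(1) r(3) by (auto simp: linear_add[OF p] linear_scale[OF p])
    \<comment> \<open>Otherwise the vertex \<open>u\<close> would lie strictly inside the segment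
      from \<open>p a\<close> to \<open>p b\<close>.\<close>
    have "p a = p b"
    proof (rule ccontr)
      assume "p a \<noteq> p b"
      hence "u \<in> open_segment (p a) (p b)" using pu r by (auto simp: in_segment)
      with u pa show False by (auto simp: hull_vertices_def extreme_point_of_def)
    qed
    moreover from this pu have "p a = u" by (simp add: algebra_simps)
    ultimately show "a \<in> ?F" "b \<in> ?F" using ab by auto
  qed (use F in auto)
  let ?E = "{e. e extreme_point_of ?F}"
  have KM: "?F = convex hull ?E" using F by (rule Krein_Milman_Minkowski)
  have xyF: "x \<in> ?F" "y \<in> ?F" using xy by (auto intro: hull_inc)
  have "\<exists>e e'. e \<in> ?E \<and> e' \<in> ?E \<and> e \<noteq> e'"
  proof (rule ccontr)
    assume "\<not> ?thesis"
    then obtain e where "?E \<subseteq> {e}" by blast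
    hence "convex hull ?E \<subseteq> {e}" by (rule hull_minimal) simp
    with KM xyF have "x = e" "y = e" by blast+
    with xy(5) show False by simp
  qed
  then obtain e e' where e: "e extreme_point_of ?F" "e' extreme_point_of ?F" "e \<noteq> e'" by auto
  with face have "e extreme_point_of ?P" "e' extreme_point_of ?P" "e \<in> ?F" "e' \<in> ?F"
    by (auto simp: extreme_point_of_face)
  with e(3) that show ?thesis by (auto simp: hull_vertices_def)
qed

section \<open>Spanning linear parts: boxed configurations\<close>

text \<open>Select linear parts that form a basis, indexed by the coordinates, and one vertex of
  \<open>E\<close> for each. A point of \<open>A\<close> violating the bounds of the functional of
  \<open>v\<close> can only be \<open>v\<close> itself, so the selected vertices are exactly the
  points of \<open>A\<close> outside the parallelepiped.\<close>

lemma boxed_if_spanning_functionals: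
  fixes A :: "(real ^ 'n) set" and b :: "real ^ 'n \<Rightarrow> real ^ 'n"
  assumes A: "configuration UNIV A" "width UNIV (convex hull A) > 1" and E: "E \<subseteq> A"
    and prim: "\<And>v. v \<in> E \<Longrightarrow> primitive_functional UNIV (\<lambda>x. b v \<bullet> x + c v)"
    and F01: "\<And>v x. v \<in> E \<Longrightarrow> x \<in> A - {v} \<Longrightarrow> b v \<bullet> x + c v \<in> {0, 1}"
    and Fv: "\<And>v. v \<in> E \<Longrightarrow> b v \<bullet> v + c v \<notin> {0, 1}"
    and span: "span (b ` E) = UNIV"
  shows "boxed A"
proof -
  obtain C where C: "C \<subseteq> b ` E" "independent C" "b ` E \<subseteq> span C"
    using maximal_independent_subset[of "b ` E"] by blast
  have "span C = UNIV" using C span by (metis span_mono span_span top.extremum_uniqueI)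
  hence "card C = dim (UNIV :: (real^'n) set)" using C(2) by (metis dim_span dim_eq_card_independent)
  hence "card C = CARD('n)" by simp
  moreover have finC: "finite C" using C(2) by (rule independent_imp_finite)
  ultimately obtain h where h: "bij_betw h (UNIV::'n set) C"
    by (metis finite finite_same_card_bij)
  have "\<forall>i. \<exists>v. v \<in> E \<and> b v = h i"
  proof
    fix i have "h i \<in> C" using h by (auto simp: bij_betw_def)
    then obtain v where "v \<in> E" "h i = b v" using C(1) by blast
    thus "\<exists>v. v \<in> E \<and> b v = h i" by auto
  qed
  then obtain v where v: "\<And>i. v i \<in> E" "\<And>i. b (v i) = h i" by metis
  \<comment> \<open>Distinct basis vectors come from distinct vertices, because \<open>b\<close>
    recovers the vector from the vertex.\<close>
  have inj: "v i = v j \<longleftrightarrow> i = j" for i j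
    using h v(2) by (metis UNIV_I bij_betw_def inj_onD)
  define f where "f i = (\<lambda>x. b (v i) \<bullet> x + c (v i))" for i
  have f01: "f i x \<in> {0, 1}" if "x \<in> A" "x \<noteq> v i" for i x
    using F01[OF v(1)[of i], of x] that by (auto simp: f_def)
  have fv: "f i (v j) \<notin> {0, 1} \<longleftrightarrow> i = j" for i j
  proof (cases "i = j")
    case True thus ?thesis using Fv[OF v(1)[of i]] by (simp add: f_def)
  next
    case False
    have "v j \<in> A" "v j \<noteq> v i" using v(1) E inj False by auto
    from f01[OF this] False show ?thesis by simp
  qed
  \<comment> \<open>An integer other than \<open>0\<close> and \<open>1\<close> also avoids the real
    interval between them, and the box is defined by that interval.\<close>
  have fvn: "f i (v i) \<notin> {0..1}" for i
  proof -
    have "v i \<in> int_lattice UNIV" using v(1) E A(1) by (auto simp: configuration_def)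
    hence "f i (v i) \<in> \<int>" using prim[OF v(1)[of i]]
      by (auto simp: f_def primitive_functional_def)
    then obtain z where "f i (v i) = of_int z" by (metis Ints_cases)
    moreover have "f i (v i) \<noteq> 0" "f i (v i) \<noteq> 1" using fv[of i i] by auto
    ultimately show ?thesis by auto
  qed
  have "A - (\<Inter>i. f i -` {0..1}) = range v"
  proof (intro equalityI subsetI)
    fix x assume "x \<in> A - (\<Inter>i. f i -` {0..1})"
    then obtain i where x: "x \<in> A" "f i x \<notin> {0..1}" by auto
    have "x = v i" using f01[OF x(1), of i] x(2) by fastforce
    thus "x \<in> range v" by blast
  next
    fix x assume "x \<in> range v"
    then obtain i where "x = v i" by blast
    thus "x \<in> A - (\<Inter>i. f i -` {0..1})" using v(1) E fvn[of i] by auto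
  qed
  moreover have "affinely_independent_functionals f"
    unfolding affinely_independent_functionals_def
  proof (intro allI impI)
    fix e :: "'n \<Rightarrow> real" and i
    assume "(\<lambda>x. \<Sum>i\<in>UNIV. e i * f i x) constant_on UNIV"
    \<comment> \<open>A constant combination has vanishing linear part, which is a linear relation
      between the basis vectors \<open>h i\<close>.\<close>
    moreover have "(\<lambda>x. \<Sum>i\<in>UNIV. e i * f i x) =
        (\<lambda>x. (\<Sum>i\<in>UNIV. e i *\<^sub>R h i) \<bullet> x + (\<Sum>i\<in>UNIV. e i * c (v i)))"
      by (simp add: f_def v(2) inner_sum_left sum.distrib distrib_left)
    ultimately have "(\<Sum>i\<in>UNIV. e i *\<^sub>R h i) = 0" by (simp add: inner_constant_on_iff)
    moreover have "(\<Sum>y\<in>C. e (inv h y) *\<^sub>R y) = (\<Sum>i\<in>UNIV. e (inv h (h i)) *\<^sub>R h i)"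
      using sum.reindex_bij_betw[OF h, of "\<lambda>y. e (inv h y) *\<^sub>R y"] by simp
    moreover have invh: "inv h (h i) = i" for i using h by (simp add: bij_betw_def)
    ultimately have "(\<Sum>y\<in>C. e (inv h y) *\<^sub>R y) = 0" by simp
    moreover have "h i \<in> C" using h by (auto simp: bij_betw_def)
    ultimately have "e (inv h (h i)) = 0" using C(2) by (auto simp: independent_explicit)
    thus "e i = 0" by (simp add: invh)
  qed
  ultimately show ?thesis
    unfolding boxed_def using A fv prim[OF v(1)]
    by (intro conjI exI[of _ f] exI[of _ v]) (auto simp: f_def)
qed

section \<open>Non-spanning linear parts: spiked configurations\<close>

text \<open>Essentiality is transported in both directions: functionals of essential vertices of
  \<open>A\<close> descend along \<open>p\<close>, and functionals on the target pull back along
  \<open>p\<close>. For the second direction, uniqueness of preimages over vertices makes the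
  deletion of a vertex commute with \<open>p\<close>.\<close>

lemma spiked_if_nonspanning_functionals:
  fixes A :: "(real ^ 'n) set" and b :: "real ^ 'n \<Rightarrow> real ^ 'n"
  assumes qm: "quasi_minimal UNIV A" and E_def: "E = essential_vertices UNIV A"
    and b: "\<And>v. v \<in> E \<Longrightarrow> b v \<in> int_lattice UNIV" "\<And>v. v \<in> E \<Longrightarrow> b v \<noteq> 0"
    and c: "\<And>v. v \<in> E \<Longrightarrow> c v \<in> \<int>"
    and F01: "\<And>v x. v \<in> E \<Longrightarrow> x \<in> A - {v} \<Longrightarrow> b v \<bullet> x + c v \<in> {0, 1}"
    and Fv: "\<And>v. v \<in> E \<Longrightarrow> b v \<bullet> v + c v \<notin> {0, 1}"
    and span: "span (b ` E) \<noteq> UNIV"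
  shows "spiked A"
proof -
  have A: "finite A" "A \<subseteq> int_lattice UNIV" and wA: "width UNIV (convex hull A) > 1"
    and uniq: "\<exists>\<^sub>\<le>\<^sub>1 v. v \<in> hull_vertices A - E"
    using qm by (auto simp: quasi_minimal_def configuration_def E_def)
  have EV: "E \<subseteq> hull_vertices A" by (auto simp: E_def essential_vertices_def)
  have VA: "hull_vertices A \<subseteq> A" using vertex_of_convex_hull_iff[OF A(1)] by auto
  have hullA: "affine hull A = UNIV" using wA by (auto simp: width_def split: if_splits)
  have bE: "b ` E \<subseteq> int_lattice UNIV" using b(1) by auto
  obtain w where w: "w \<in> int_lattice UNIV" "w \<noteq> 0" "\<And>v. v \<in> E \<Longrightarrow> w \<bullet> b v = 0"
    by (rule integer_orthogonal_vector[OF bE span]) blast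
  obtain i and p q :: "real ^ 'n \<Rightarrow> real ^ 'n" where p: "linear p" and q: "linear q"
    and pL: "p ` int_lattice UNIV = int_lattice (- {i})" and pU: "p ` UNIV = coord_space (- {i})"
    and qL: "q ` int_lattice UNIV \<subseteq> int_lattice UNIV"
    and qp: "\<And>a x. a \<bullet> w = 0 \<Longrightarrow> a \<bullet> q (p x) = a \<bullet> x"
    by (rule lattice_projection_along[OF w(1,2)]) blast
  let ?K = "- {i}"
  define F where "F v x = b v \<bullet> x + c v" for v x
  \<comment> \<open>This is \<open>F v\<close> descended to the target; composing with
    \<open>q\<close> defines it there without choosing preimages.\<close>
  define G where "G v y = F v (q y)" for v y
  have GF: "G v (p x) = F v x" if "v \<in> E" for v x
    using w(3)[OF that] qp[of "b v" x] by (simp add: G_def F_def inner_commute)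
  \<comment> \<open>\<open>F v\<close> is constant on the fibres of \<open>p\<close>, and
    \<open>v\<close> is the only point of \<open>A\<close> where it leaves
    \<open>{0, 1}\<close>.\<close>
  have E_eq: "x = v" if "v \<in> E" "x \<in> A" "p x = p v" for v x
  proof (rule ccontr)
    assume "x \<noteq> v"
    hence "F v x \<in> {0, 1}" using F01 that by (auto simp: F_def)
    moreover have "F v x = F v v" using GF[OF that(1)] that(3) by metis
    ultimately show False using Fv[OF that(1)] by (simp add: F_def)
  qed
  have finpA: "finite (p ` A)" using A by simp
  have unique: "x = y" if u: "u \<in> hull_vertices (p ` A)" and xy: "x \<in> A" "y \<in> A" "p x = u" "p y = u" for u x y
  proof (rule ccontr)
    assume "x \<noteq> y"
    from two_vertices_in_fibre[where p = p, OF A(1) p u xy this] obtain e e' where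
      e: "e \<in> hull_vertices A" "e' \<in> hull_vertices A" "p e = u" "p e' = u" "e \<noteq> e'" .
    \<comment> \<open>Of two distinct vertices of \<open>A\<close>, quasi-minimality makes at least
      one essential.\<close>
    with uniq have "e \<in> E \<or> e' \<in> E" unfolding Uniq_def by blast
    thus False using E_eq e VA by (metis subsetD)
  qed
  have affp: "affine_map p" using p by (auto simp: affine_map_def intro!: exI[of _ p] exI[of _ 0])
  have Gint: "integer_functional ?K (G v)" and Gnc: "\<not> G v constant_on coord_space ?K"
    if v: "v \<in> E" for v
  proof -
    have "linear (\<lambda>y. b v \<bullet> q y)"
      using linear_compose[OF q bounded_linear.linear[OF bounded_linear_inner_right[of "b v"]]]
      by (simp add: o_def)
    hence "affine_map (G v)" by (auto simp: affine_map_def G_def F_def fun_eq_iff)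
    moreover have "G v y \<in> \<int>" if "y \<in> int_lattice ?K" for y
    proof -
      have "y \<in> int_lattice UNIV" using that by (auto simp: int_lattice_def)
      hence "q y \<in> int_lattice UNIV" using qL by blast
      thus ?thesis using b(1)[OF v] c[OF v] by (auto simp: G_def F_def intro: Ints_add inner_int_lattice)
    qed
    ultimately show "integer_functional ?K (G v)" by (auto simp: integer_functional_def)
    show "\<not> G v constant_on coord_space ?K"
    proof
      assume "G v constant_on coord_space ?K"
      hence "(\<lambda>x. G v (p x)) constant_on UNIV" unfolding constant_on_def pU[symmetric] by auto
      with GF[OF v] have "F v constant_on UNIV" by simp
      thus False using b(2)[OF v] inner_constant_on_iff[of "b v" "c v"] by (simp add: F_def[abs_def])
    qed
  qed
  have into: "p v \<in> essential_vertices ?K (p ` A)" if v: "v \<in> E" for v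
  proof -
    have vA: "v \<in> A" using v EV VA by blast
    have G01: "G v y \<in> {0, 1}" if y: "y \<in> p ` A - {p v}" for y
    proof -
      obtain x where "x \<in> A - {v}" "y = p x" using y by auto
      thus ?thesis using F01[OF v] GF[OF v] by (simp add: F_def)
    qed
    \<comment> \<open>Integrality puts \<open>G v (p v)\<close> outside the whole interval
      \<open>{0..1}\<close>, so \<open>G v\<close> separates \<open>p v\<close> from the hull of the
      other image points.\<close>
    have "G v (p v) \<in> \<int>" using Gint[OF v] vA A(2) pL by (auto simp: integer_functional_def)
    then obtain z where "G v (p v) = of_int z" by (metis Ints_cases)
    moreover have "G v (p v) \<notin> {0, 1}" using Fv[OF v] GF[OF v] by (simp add: F_def)
    ultimately have "G v (p v) \<notin> {0..1}" by auto
    moreover have "G v ` (p ` A - {p v}) \<subseteq> {0..1}" using G01 by force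
    moreover have "affine_map (G v)" using Gint[OF v] by (simp add: integer_functional_def)
    ultimately have "p v \<notin> convex hull (p ` A - {p v})"
      using affine_map_bounds_convex_hull by metis
    hence "p v \<in> hull_vertices (p ` A)" using vA vertex_of_convex_hull_iff[OF finpA] by blast
    moreover have "width ?K (convex hull (p ` A - {p v})) \<le> 1"
    proof (rule width_convex_hull_le_1I[OF Gint[OF v] Gnc[OF v]])
      fix x y assume "x \<in> p ` A - {p v}" "y \<in> p ` A - {p v}"
      from G01[OF this(1)] G01[OF this(2)] show "G v x - G v y \<le> 1" by auto
    qed (use finpA in simp)
    ultimately show ?thesis by (simp add: essential_vertices_def)
  qed
  have onto: "u \<in> p ` E" if u: "u \<in> essential_vertices ?K (p ` A)" for u
  proof -
    have uV: "u \<in> hull_vertices (p ` A)" and wu: "width ?K (convex hull (p ` A - {u})) \<le> 1"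
      using u by (auto simp: essential_vertices_def)
    have "u \<in> p ` A" and uh: "u \<notin> convex hull (p ` A - {u})"
      using uV vertex_of_convex_hull_iff[OF finpA] by auto
    then obtain v where v: "v \<in> A" "p v = u" by blast
    have img: "p ` (A - {v}) = p ` A - {u}" using v unique[OF uV] by blast
    have "v \<notin> convex hull (A - {v})"
    proof
      assume "v \<in> convex hull (A - {v})"
      hence "p v \<in> convex hull (p ` (A - {v}))" using convex_hull_linear_image[OF p] by blast
      with uh img v show False by simp
    qed
    hence vV: "v \<in> hull_vertices A" using v vertex_of_convex_hull_iff[OF A(1)] by blast
    \<comment> \<open>If \<open>A - {v}\<close> is flat, its width is \<open>0\<close> by default.
      Otherwise its image is full-dimensional too, and the small width downstairs yields a genuine
      functional to pull back.\<close>
    have "width UNIV (convex hull (A - {v})) \<le> 1"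
    proof (cases "affine hull (A - {v}) = UNIV")
      case True
      have "p ` (affine hull (A - {v})) = affine hull (p ` (A - {v}))"
        using p by (intro affine_hull_linear_image) (simp add: linear_linear)
      hence full: "affine hull (p ` A - {u}) = coord_space ?K" using True img pU by simp
      \<comment> \<open>A target of rank \<open>0\<close> is excluded here: it would put all of
        \<open>A\<close> into one fibre, so \<open>A = {v}\<close> and \<open>A - {v}\<close> would
        be empty.\<close>
      have "?K \<noteq> {}"
      proof
        assume "?K = {}"
        hence "p ` UNIV = {0}" using pU by (auto simp: coord_space_def vec_eq_iff)
        hence "p x = p y" for x y by (metis rangeI singletonD)
        hence "x = v" if "x \<in> A" for x using unique[OF uV that v(1)] v(2) by metis
        hence "A - {v} = {}" by auto
        with True show False by simp
      qed
      have sub: "p ` A - {u} \<subseteq> int_lattice ?K" using A(2) pL by blast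
      obtain f where f: "integer_functional ?K f" "\<not> f constant_on coord_space ?K"
        "\<And>x y. x \<in> p ` A - {u} \<Longrightarrow> y \<in> p ` A - {u} \<Longrightarrow> f x - f y \<le> 1"
        using width_convex_hull_le_1E[OF wu full \<open>?K \<noteq> {}\<close> _ sub] finpA by blast
      have "affine_map (\<lambda>x. f (p x))"
      proof -
        obtain l k where "linear l" "f = (\<lambda>x. l x + k)"
          using f(1) by (auto simp: integer_functional_def affine_map_def)
        thus ?thesis using linear_compose[OF p, of l] by (auto simp: affine_map_def o_def)
      qed
      hence "integer_functional UNIV (\<lambda>x. f (p x))"
        using f(1) pL by (auto simp: integer_functional_def)
      moreover have "\<not> (\<lambda>x. f (p x)) constant_on coord_space UNIV"
        using f(2) unfolding constant_on_def pU[symmetric] by auto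
      ultimately show ?thesis
        by (rule width_convex_hull_le_1I) (use A f(3) img in blast)+
    qed (simp add: width_def)
    hence "v \<in> E" using vV by (simp add: E_def essential_vertices_def)
    thus ?thesis using v(2) by blast
  qed
  have "bij_betw p E (essential_vertices ?K (p ` A))"
    unfolding bij_betw_def
  proof
    show "inj_on p E" using E_eq EV VA by (auto intro!: inj_onI)
    show "p ` E = essential_vertices ?K (p ` A)" using into onto by blast
  qed
  moreover have "\<exists>!x. x \<in> A \<and> p x = u" if "u \<in> hull_vertices (p ` A)" for u
  proof -
    have "u \<in> p ` A" using that vertex_of_convex_hull_iff[OF finpA] by simp
    then obtain x where "x \<in> A" "p x = u" by blast
    thus ?thesis using unique[OF that] by (intro ex1I[of _ x]) auto
  qed
  ultimately have "spiked_wrt i p A"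
    using affp pL by (simp add: spiked_wrt_def E_def)
  with qm show ?thesis by (auto simp: spiked_def)
qed

theorem theorem4:
  fixes A :: "(real ^ 'n::finite) set"
  assumes "quasi_minimal UNIV A"
  shows "spiked A \<or> boxed A"
proof -
  let ?E = "essential_vertices UNIV A"
  have A: "finite A" "A \<subseteq> int_lattice UNIV" and wA: "width UNIV (convex hull A) > 1"
    using assms by (auto simp: quasi_minimal_def configuration_def)
  have ex: "\<forall>v\<in>?E. \<exists>b c. b \<in> int_lattice UNIV \<and> c \<in> \<int> \<and> b \<noteq> 0 \<and>
    primitive_functional UNIV (\<lambda>x. b \<bullet> x + c) \<and>
    (\<forall>x\<in>A - {v}. b \<bullet> x + c \<in> {0, 1}) \<and> b \<bullet> v + c \<notin> {0, 1}"
  proof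
    fix v assume "v \<in> ?E"
    hence "width UNIV (convex hull (A - {v})) \<le> 1" by (simp add: essential_vertices_def)
    show "\<exists>b c. b \<in> int_lattice UNIV \<and> c \<in> \<int> \<and> b \<noteq> 0 \<and>
      primitive_functional UNIV (\<lambda>x. b \<bullet> x + c) \<and>
      (\<forall>x\<in>A - {v}. b \<bullet> x + c \<in> {0, 1}) \<and> b \<bullet> v + c \<notin> {0, 1}"
      by (rule essential_vertex_functional[OF A wA \<open>width UNIV (convex hull (A - {v})) \<le> 1\<close>]) blast
  qed
  obtain b where "\<forall>v\<in>?E. \<exists>c. b v \<in> int_lattice UNIV \<and> c \<in> \<int> \<and> b v \<noteq> 0 \<and>
    primitive_functional UNIV (\<lambda>x. b v \<bullet> x + c) \<and>
    (\<forall>x\<in>A - {v}. b v \<bullet> x + c \<in> {0, 1}) \<and> b v \<bullet> v + c \<notin> {0, 1}"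
    using bchoice[OF ex] by blast
  from bchoice[OF this] obtain c where
    bc: "\<And>v. v \<in> ?E \<Longrightarrow> b v \<in> int_lattice UNIV \<and> c v \<in> \<int> \<and> b v \<noteq> 0 \<and>
      primitive_functional UNIV (\<lambda>x. b v \<bullet> x + c v) \<and>
      (\<forall>x\<in>A - {v}. b v \<bullet> x + c v \<in> {0, 1}) \<and> b v \<bullet> v + c v \<notin> {0, 1}"
    by blast
  show ?thesis
  proof (cases "span (b ` ?E) = UNIV")
    case True
    have "?E \<subseteq> A" using vertex_of_convex_hull_iff[OF A(1)] by (auto simp: essential_vertices_def)
    with A wA bc True have "boxed A"
      by (intro boxed_if_spanning_functionals[of A ?E b c]) (auto simp: configuration_def)
    thus ?thesis ..
  next
    case False
    with bc have "spiked A"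
      by (intro spiked_if_nonspanning_functionals[OF assms refl, of b c]) auto
    thus ?thesis ..
  qed
qed

end
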